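(* For $(p,q)\in\mathbf{N}$ and every $t\in\mathbb{R}$, the moment generating function $m_{\Lambda^*_{p,q}}(t)=\mathbb{E}\exp(t\Lambda^*_{p,q})$ satisfies $$m_{\Lambda_{p,q}^*}(t)=\frac{e^{3t}}{\pi}\int_0^\pi e^{2t\cos\theta}\,\widehat{I}_0\left(4t\,\alpha_{p,q}(\theta),\,4t\,\beta_{p,q}(\theta),\,p,\,q\right)d\theta,$$ where $$\widehat{I}_0(\alpha,\beta,p,q)=\frac{1}{p+q}\sum_{j=0}^{p+q-1}\exp\left(\alpha\cos\left(\frac{2\pi j}{p+q}\right)+\beta\sin\left(\frac{2\pi j}{p+q}\right)\right),$$ $$\alpha_{p,q}(\theta)=\cos\left(\frac{\theta}{2}\right)\cos\left(\frac{\theta(p-q)}{2(p+q)}\right),\qquad \beta_{p,q}(\theta)=\cos\left(\frac{\theta}{2}\right)\sin\left(\frac{\theta(p-q)}{2(p+q)}\right).$$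
   Context: $\mathbb{N}_0=\{0,1,2,\ldots\}$ and $\mathbf{N}:=\{(p,q)\in\mathbb{N}_0^2 : p+q\ge 5,\ q\le p\}$. For such $(p,q)$, $\Lambda^*_{p,q}$ denotes the random eigenvalue of the dual infinite $(p,q)$-nanotube (the triangular lattice with a loop of weight $3$ at each vertex, rolled up along the chiral vector $(p,q)$), i.e. the real random variable with compactly supported distribution whose moments $\mu_k(\Lambda^*_{p,q})=\mathbb{E}(\Lambda^*_{p,q})^k$, $k\in\mathbb{N}_0$, are the (weighted) numbers of closed paths with $k$ steps from a vertex of this graph, given by $$\mu_k(\Lambda^*_{p,q})=\frac{1}{(2\pi)^3}\sum_{j\in\mathbb{Z}}\int_{-\pi}^{\pi}\int_{-\pi}^{\pi}\int_{-\pi}^{\pi}\left|e^{ix}+e^{iy}+e^{iz}\right|^{2k}e^{ij(p(x-z)+q(y-z))}\,dx\,dy\,dz .$$ For each fixed $k$ only finitely many terms of the sum are non-zero, and these moments determine the (compactly supported) distribution of $\Lambda^*_{p,q}$ uniquely. *)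

theory Defs
  imports "HOL-Probability.Probability"
begin

definition nanotube_params :: "(nat \<times> nat) set" where
  "nanotube_params = {(p, q). p + q \<ge> 5 \<and> q \<le> p}"

(* The summation index runs over all integers; for each fixed k only finitely many
   summands are nonzero, so infsum is an ordinary finite sum. *)
definition dual_moment :: "nat \<Rightarrow> nat \<Rightarrow> nat \<Rightarrow> complex" where
  "dual_moment p q k =
     1 / (2 * of_real pi) ^ 3 *
     (\<Sum>\<^sub>\<infinity>j\<in>(UNIV :: int set).
        integral {-pi..pi} (\<lambda>z. integral {-pi..pi} (\<lambda>y. integral {-pi..pi} (\<lambda>x.
          of_real (cmod (exp (\<i> * of_real x) + exp (\<i> * of_real y) + exp (\<i> * of_real z)) ^ (2 * k))
          * exp (\<i> * of_int j * of_real (real p * (x - z) + real q * (y - z)))))))"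

(* The random eigenvalue of the dual infinite (p,q)-nanotube is determined only in
   distribution, so it is a property of a random variable X on a probability space M.
   The moments are those of the closed-path counts on the triangular lattice with loops
   of weight 3, rolled up along the chiral vector (p,q). *)
definition dual_random_eigenvalue :: "nat \<Rightarrow> nat \<Rightarrow> 'a measure \<Rightarrow> ('a \<Rightarrow> real) \<Rightarrow> bool" where
  "dual_random_eigenvalue p q M X \<longleftrightarrow>
     prob_space M \<and> X \<in> borel_measurable M \<and>
     (\<exists>K. compact K \<and> (AE \<omega> in M. X \<omega> \<in> K)) \<and>
     (\<forall>k. of_real (\<integral>\<omega>. X \<omega> ^ k \<partial>M) = dual_moment p q k)"

definition mgf :: "'a measure \<Rightarrow> ('a \<Rightarrow> real) \<Rightarrow> real \<Rightarrow> real" where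
  "mgf M X t = (\<integral>\<omega>. exp (t * X \<omega>) \<partial>M)"

definition I0_hat :: "real \<Rightarrow> real \<Rightarrow> nat \<Rightarrow> nat \<Rightarrow> real" where
  "I0_hat a b p q =
     1 / real (p + q) *
     (\<Sum>j = 0..p + q - 1. exp (a * cos (2 * pi * real j / real (p + q))
                             + b * sin (2 * pi * real j / real (p + q))))"

definition alpha :: "nat \<Rightarrow> nat \<Rightarrow> real \<Rightarrow> real" where
  "alpha p q \<theta> = cos (\<theta> / 2) * cos (\<theta> * (real p - real q) / (2 * (real p + real q)))"

definition beta :: "nat \<Rightarrow> nat \<Rightarrow> real \<Rightarrow> real" where
  "beta p q \<theta> = cos (\<theta> / 2) * sin (\<theta> * (real p - real q) / (2 * (real p + real q)))"

end

theory Submission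
  imports Defs
begin

text \<open>With a = x - z and b = y - z, the integrand of the k-th moment is the k-th power of
  F(a, b) = 3 + 2 cos a + 2 cos b + 2 cos (a - b), a trigonometric polynomial, and the sum over j
  adds up its Fourier coefficients at the integer multiples of (p, q). By Poisson summation this
  is the average of the k-th power of F over the annihilator of (p, q), the closed
  one-dimensional group of all (a, b) with p a + q b in 2 pi Z. In suitable coordinates on this group
  F becomes the exponent of the asserted formula. Summing the exponential series, which is
  legitimate as everything is bounded, passes from moments to moment generating functions.\<close>

section \<open>Orthogonality of characters and exponential series of moments\<close>

text \<open>For a nonzero integer \<open>m\<close> the antiderivative
  \<open>cis (m x) / (i m)\<close> takes the same value at both ends of the full period.\<close>

lemma has_integral_cis_int:
  "((\<lambda>x. cis (of_int m * x)) has_integral (if m = 0 then of_real (2 * pi) else 0)) {-pi..pi}"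
proof (cases "m = 0")
  case True
  then show ?thesis
    using has_integral_const_real[of "1::complex" "-pi" pi] by (simp add: scaleR_conv_of_real)
next
  case False
  have "((\<lambda>x. cis (of_int m * x)) has_integral
      cis (of_int m * pi) / (\<i> * of_int m) - cis (of_int m * (-pi)) / (\<i> * of_int m)) {-pi..pi}"
  proof (rule fundamental_theorem_of_calculus)
    show "((\<lambda>x. cis (of_int m * x) / (\<i> * of_int m)) has_vector_derivative cis (of_int m * x))
        (at x within {-pi..pi})" for x
      using False unfolding cis_conv_exp of_real_mult of_real_of_int_eq
      by (auto intro!: derivative_eq_intros has_vector_derivative_real_field simp: field_simps)
  qed simp
  moreover have "cis (of_int m * pi) = cis (of_int m * (-pi))"
    by (simp add: complex_eq_iff sin_int_times_real sin_times_pi_eq_0)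
  ultimately show ?thesis using False by simp
qed

text \<open>This is a geometric sum in \<open>w = cis (2 pi s / n)\<close>, which satisfies
  \<open>w ^ n = 1\<close>. It vanishes unless \<open>w = 1\<close>, and that happens exactly when
  \<open>n\<close> divides \<open>s\<close>.\<close>

lemma sum_cis_roots:
  assumes "n > 0"
  shows "(\<Sum>j<n. cis (2 * pi * real j * of_int s / real n)) = (if int n dvd s then of_nat n else 0)"
proof -
  define w where "w = cis (2 * pi * of_int s / real n)"
  have pow: "cis (2 * pi * real j * of_int s / real n) = w ^ j" for j
    unfolding w_def Complex.DeMoivre by (intro arg_cong[of _ _ cis]) simp
  have w_n: "w ^ n = 1"
    unfolding w_def Complex.DeMoivre using assms cis_multiple_2pi[of "of_int s"] by simp
  have w_1: "w = 1 \<longleftrightarrow> int n dvd s"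
  proof
    assume "w = 1"
    then have "cos (2 * pi * of_int s / real n) = 1" by (simp add: w_def complex_eq_iff)
    then obtain k :: int where "2 * pi * of_int s / real n = of_int k * 2 * pi"
      by (auto simp: cos_one_2pi_int)
    then have "real_of_int s = of_int (k * int n)" using assms by (simp add: field_simps)
    then have "s = k * int n" by linarith
    then show "int n dvd s" by simp
  next
    assume "int n dvd s"
    then obtain k where "s = int n * k" ..
    then have "2 * pi * of_int s / real n = 2 * pi * of_int k" using assms by simp
    then show "w = 1" unfolding w_def by (simp only: cis_multiple_2pi Ints_of_int)
  qed
  show ?thesis
    unfolding pow using w_1 w_n by (cases "w = 1") (auto simp: geometric_sum)
qed

text \<open>The \<open>k\<close>-th term of the exponential series is at most
  \<open>(\<bar>t\<bar> * B) ^ k / fact k\<close> almost everywhere. On a finite measure space these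
  bounds have summable integrals, so sum and integral may be exchanged.\<close>

lemma exp_moments_sums:
  fixes f :: "'a \<Rightarrow> real"
  assumes "finite_measure M" and [measurable]: "f \<in> borel_measurable M"
    and bound: "AE x in M. \<bar>f x\<bar> \<le> B"
  shows "(\<lambda>k. t ^ k / fact k * (\<integral>x. f x ^ k \<partial>M)) sums (\<integral>x. exp (t * f x) \<partial>M)"
proof -
  interpret finite_measure M by fact
  have bnd: "AE x in M. norm (t ^ k / fact k * f x ^ k) \<le> (\<bar>t\<bar> * B) ^ k / fact k" for k
    using bound
  proof eventually_elim
    case (elim x)
    have "norm (t ^ k / fact k * f x ^ k) = (\<bar>t\<bar> * \<bar>f x\<bar>) ^ k / fact k"
      by (simp add: abs_mult power_abs power_mult_distrib)
    also have "\<dots> \<le> (\<bar>t\<bar> * B) ^ k / fact k"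
      using elim by (intro divide_right_mono power_mono mult_left_mono) auto
    finally show ?case .
  qed
  have int: "integrable M (\<lambda>x. t ^ k / fact k * f x ^ k)" for k
    by (rule integrable_const_bound[OF bnd]) measurable
  have exp: "(\<lambda>k. y ^ k / fact k) sums exp y" for y :: real
    using exp_converges[of y] by (simp add: scaleR_conv_of_real field_simps)
  have "(\<lambda>k. \<integral>x. t ^ k / fact k * f x ^ k \<partial>M) sums (\<integral>x. (\<Sum>k. t ^ k / fact k * f x ^ k) \<partial>M)"
  proof (rule sums_integral)
    show "AE x in M. summable (\<lambda>k. norm (t ^ k / fact k * f x ^ k))"
    proof (rule AE_I2)
      fix x
      have "norm (t ^ k / fact k * f x ^ k) = \<bar>t * f x\<bar> ^ k / fact k" for k
        by (simp add: abs_mult power_abs power_mult_distrib)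
      then show "summable (\<lambda>k. norm (t ^ k / fact k * f x ^ k))"
        using exp by (auto simp: sums_iff)
    qed
    have "(\<integral>x. norm (t ^ k / fact k * f x ^ k) \<partial>M) \<le> (\<bar>t\<bar> * B) ^ k / fact k * measure M (space M)" for k
      using integral_mono_AE[OF integrable_norm[OF int] integrable_const bnd, of k]
      by (simp add: mult.commute)
    moreover have "summable (\<lambda>k. (\<bar>t\<bar> * B) ^ k / fact k * measure M (space M))"
      using exp[of "\<bar>t\<bar> * B"] by (intro summable_mult2) (simp add: sums_iff)
    ultimately show "summable (\<lambda>k. \<integral>x. norm (t ^ k / fact k * f x ^ k) \<partial>M)"
      by - (rule summable_comparison_test'[where N = 0], assumption, subst real_norm_def, subst abs_of_nonneg, auto)
  qed (fact int)
  moreover have "(\<Sum>k. t ^ k / fact k * f x ^ k) = exp (t * f x)" for x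
    using exp[of "t * f x"] by (simp add: sums_iff power_mult_distrib)
  ultimately show ?thesis by simp
qed

lemma integral_sum_cis:
  assumes "finite S"
  shows "integral {-pi..pi} (\<lambda>x. \<Sum>g\<in>S. c g * cis (of_int (m g) * x)) =
    (\<Sum>g\<in>S. c g * (if m g = 0 then of_real (2 * pi) else 0))"
  by (intro integral_unique has_integral_sum has_integral_mult_right has_integral_cis_int assms)

section \<open>The trigonometric polynomial of the triangular lattice\<close>

text \<open>The Fourier symbol of the triangular lattice with loops: the loop of weight 3 is the
  constant, and each pair of opposite neighbours gives one cosine.\<close>

definition tri_weight :: "real \<Rightarrow> real \<Rightarrow> real" where
  "tri_weight a b = 3 + 2 * cos a + 2 * cos b + 2 * cos (a - b)"

lemma cmod_sum_sq_eq_tri_weight: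
  "cmod (exp (\<i> * of_real x) + exp (\<i> * of_real y) + exp (\<i> * of_real z)) ^ 2 = tri_weight (x - z) (y - z)"
proof -
  have "x - z - (y - z) = x - y" by simp
  moreover have "cos x * cos x + (cos y * cos y + (cos z * cos z + (sin x * sin x + (sin y * sin y + sin z * sin z)))) = 3"
    using sin_cos_squared_add3[of x] sin_cos_squared_add3[of y] sin_cos_squared_add3[of z] by linarith
  ultimately show ?thesis
    unfolding cmod_power2 cis_conv_exp[symmetric] tri_weight_def
    by (simp add: cos_diff power2_eq_square algebra_simps)
qed

text \<open>Indexes the product of \<open>1 + cis a + cis b\<close> with its conjugate. Pairs are
  kept instead of their differences to retain multiplicities: the difference (0, 0) arises three
  times and yields the constant 3.\<close>

definition tri_steps :: "((int \<times> int) \<times> (int \<times> int)) set" where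
  "tri_steps = {(0, 0), (1, 0), (0, 1)} \<times> {(0, 0), (1, 0), (0, 1)}"

lemma tri_weight_eq_sum:
  "of_real (tri_weight a b) =
    (\<Sum>(u, v)\<in>tri_steps. cis (of_int (fst u - fst v) * a + of_int (snd u - snd v) * b))"
  unfolding tri_steps_def sum.cartesian_product[symmetric] tri_weight_def
  by (simp add: complex_eq_iff cos_diff sin_diff)

text \<open>Multiplying out the \<open>k\<close> factors picks one term from each, so
  \<open>S\<close> consists of the walks with \<open>k\<close> steps, and \<open>m\<close>,
  \<open>l\<close> are the coordinates of the total displacement. All coefficients are 1, which
  turns Fourier coefficients into counts.\<close>

lemma tri_weight_power_eq_sum:
  obtains S :: "(nat \<Rightarrow> (int \<times> int) \<times> (int \<times> int)) set" and m l
  where "finite S" and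
    "\<And>a b. of_real (tri_weight a b) ^ k = (\<Sum>g\<in>S. cis (of_int (m g) * a + of_int (l g) * b))"
proof
  define m where "m g = (\<Sum>i<k. fst (fst (g i)) - fst (snd (g i)))"
    for g :: "nat \<Rightarrow> (int \<times> int) \<times> (int \<times> int)"
  define l where "l g = (\<Sum>i<k. snd (fst (g i)) - snd (snd (g i)))"
    for g :: "nat \<Rightarrow> (int \<times> int) \<times> (int \<times> int)"
  have fin: "finite tri_steps" by (simp add: tri_steps_def)
  then show "finite (PiE {..<k} (\<lambda>_. tri_steps))" by (simp add: finite_PiE)
  show "of_real (tri_weight a b) ^ k =
    (\<Sum>g\<in>PiE {..<k} (\<lambda>_. tri_steps). cis (of_int (m g) * a + of_int (l g) * b))" for a b
  proof -
    define \<phi> where "\<phi> s = of_int (fst (fst s) - fst (snd s)) * a + of_int (snd (fst s) - snd (snd s)) * b"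
      for s :: "(int \<times> int) \<times> (int \<times> int)"
    have prod_cis: "(\<Prod>i<k. cis (\<phi> (g i))) = cis (of_int (m g) * a + of_int (l g) * b)" for g
    proof -
      have "(\<Prod>i<k. cis (\<phi> (g i))) = cis (\<Sum>i<k. \<phi> (g i))"
        by (simp add: cis_conv_exp exp_sum sum_distrib_left)
      also have "(\<Sum>i<k. \<phi> (g i)) = of_int (m g) * a + of_int (l g) * b"
        by (simp add: \<phi>_def m_def l_def sum.distrib sum_distrib_right)
      finally show ?thesis .
    qed
    have "of_real (tri_weight a b) ^ k = (\<Prod>i<k. \<Sum>s\<in>tri_steps. cis (\<phi> s))"
      by (simp add: tri_weight_eq_sum \<phi>_def split_beta)
    also have "\<dots> = (\<Sum>g\<in>PiE {..<k} (\<lambda>_. tri_steps). \<Prod>i<k. cis (\<phi> (g i)))"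
      using fin by (simp only: prod_sum_PiE finite_lessThan)
    also have "\<dots> = (\<Sum>g\<in>PiE {..<k} (\<lambda>_. tri_steps). cis (of_int (m g) * a + of_int (l g) * b))"
      by (simp only: prod_cis)
    finally show ?thesis .
  qed
qed

section \<open>Moments as numbers of closed walks\<close>

lemma has_sum_sum:
  fixes f :: "'i \<Rightarrow> 'b \<Rightarrow> 'c :: topological_comm_monoid_add"
  assumes "\<And>i. i \<in> S \<Longrightarrow> (f i has_sum c i) A"
  shows "((\<lambda>x. \<Sum>i\<in>S. f i x) has_sum (\<Sum>i\<in>S. c i)) A"
  using assms by (induction S rule: infinite_finite_induct) (auto intro: has_sum_add)

text \<open>The \<open>j\<close>-th triple integral keeps exactly the walks with displacement -j (p,
  q). Summing over \<open>j\<close> counts the walks that close up once the lattice is rolled up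
  along (p, q).\<close>

lemma dual_moment_eq_count:
  assumes "p + q > 0" and "finite S"
    and S: "\<And>a b. of_real (tri_weight a b) ^ k = (\<Sum>g\<in>S. cis (of_int (m g) * a + of_int (l g) * b))"
  shows "dual_moment p q k = (\<Sum>g\<in>S. if \<exists>s. m g = s * int p \<and> l g = s * int q then 1 else 0)"
proof -
  define G where "G j x y z = of_real (cmod (exp (\<i> * of_real x) + exp (\<i> * of_real y) + exp (\<i> * of_real z)) ^ (2 * k))
          * exp (\<i> * of_int j * of_real (real p * (x - z) + real q * (y - z)))" for j :: int and x y z
  \<comment> \<open>The variables are separated so that the integrals can be evaluated from the
    inside out, the other factors acting as coefficients.\<close>
  have G: "G j x y z = (\<Sum>g\<in>S. (cis (of_int (- m g - l g - j * (int p + int q)) * z)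
      * cis (of_int (l g + j * int q) * y)) * cis (of_int (m g + j * int p) * x))" for j x y z
  proof -
    have "exp (\<i> * of_int j * of_real (real p * (x - z) + real q * (y - z)))
      = cis (of_int j * (real p * (x - z) + real q * (y - z)))"
      by (simp add: cis_conv_exp mult.assoc)
    then have "G j x y z = of_real (tri_weight (x - z) (y - z)) ^ k
        * cis (of_int j * (real p * (x - z) + real q * (y - z)))"
      unfolding G_def power_mult cmod_sum_sq_eq_tri_weight by simp
    also have "\<dots> = (\<Sum>g\<in>S. cis (of_int (m g) * (x - z) + of_int (l g) * (y - z)
        + of_int j * (real p * (x - z) + real q * (y - z))))"
      by (simp add: S sum_distrib_right cis_mult)
    also have "\<dots> = (\<Sum>g\<in>S. (cis (of_int (- m g - l g - j * (int p + int q)) * z)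
      * cis (of_int (l g + j * int q) * y)) * cis (of_int (m g + j * int p) * x))"
      by (intro sum.cong refl) (simp add: cis_mult algebra_simps)
    finally show ?thesis .
  qed
  define D where "D i = (if i = 0 then complex_of_real (2 * pi) else 0)" for i :: int
  \<comment> \<open>The frequency in \<open>z\<close> is minus the sum of the other two, so it
    vanishes as soon as they do.\<close>
  have D3: "D (m g + j * int p) * D (l g + j * int q) * D (- m g - l g - j * (int p + int q)) =
      (2 * of_real pi) ^ 3 * (if m g = - j * int p \<and> l g = - j * int q then 1 else 0)" for g j
    by (auto simp: D_def power3_eq_cube algebra_simps)
  have "integral {-pi..pi} (\<lambda>z. integral {-pi..pi} (\<lambda>y. integral {-pi..pi} (\<lambda>x. G j x y z))) =
    (\<Sum>g\<in>S. D (m g + j * int p) * D (l g + j * int q) * D (- m g - l g - j * (int p + int q)))" for j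
  proof -
    have x: "integral {-pi..pi} (\<lambda>x. G j x y z) =
      (\<Sum>g\<in>S. (D (m g + j * int p) * cis (of_int (- m g - l g - j * (int p + int q)) * z))
        * cis (of_int (l g + j * int q) * y))" for y z
      unfolding G integral_sum_cis[OF \<open>finite S\<close>] D_def by (intro sum.cong) auto
    have y: "integral {-pi..pi} (\<lambda>y. integral {-pi..pi} (\<lambda>x. G j x y z)) =
      (\<Sum>g\<in>S. (D (m g + j * int p) * D (l g + j * int q))
        * cis (of_int (- m g - l g - j * (int p + int q)) * z))" for z
      unfolding x integral_sum_cis[OF \<open>finite S\<close>] D_def by (intro sum.cong) auto
    show ?thesis
      unfolding y integral_sum_cis[OF \<open>finite S\<close>] D_def by (intro sum.cong) auto
  qed
  then have int: "integral {-pi..pi} (\<lambda>z. integral {-pi..pi} (\<lambda>y. integral {-pi..pi} (\<lambda>x. G j x y z))) =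
    (\<Sum>g\<in>S. (2 * of_real pi) ^ 3 * (if m g = - j * int p \<and> l g = - j * int q then 1 else 0))" for j
    by (simp only: D3)
  have "((\<lambda>j. if m g = - j * int p \<and> l g = - j * int q then 1 else 0) has_sum
      (if \<exists>s. m g = s * int p \<and> l g = s * int q then 1 else 0 :: complex)) UNIV" for g
  proof (cases "\<exists>s. m g = s * int p \<and> l g = s * int q")
    case True
    then obtain s where s: "m g = s * int p" "l g = s * int q" by auto
    \<comment> \<open>Since (p, q) is not (0, 0), the multiple \<open>s\<close> is unique, and a
      single \<open>j\<close> contributes.\<close>
    have "m g = - j * int p \<and> l g = - j * int q \<longleftrightarrow> j = - s" for j
      using \<open>p + q > 0\<close> s by (auto simp flip: mult_minus_left simp del: minus_mult_minus)
    moreover have "(\<exists>s. m g = s * int p \<and> l g = s * int q) = True" using True by blast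
    ultimately show ?thesis
      by (intro has_sum_finite_neutralI[of "{- s}"]) (simp_all only:, simp_all)
  next
    case False
    then have "\<not> (m g = - j * int p \<and> l g = - j * int q)" for j by blast
    then show ?thesis using False by (simp only: if_False has_sum_0)
  qed
  then have "((\<lambda>j. \<Sum>g\<in>S. (2 * of_real pi) ^ 3 * (if m g = - j * int p \<and> l g = - j * int q then 1 else 0)) has_sum
      (\<Sum>g\<in>S. (2 * of_real pi) ^ 3 * (if \<exists>s. m g = s * int p \<and> l g = s * int q then 1 else 0 :: complex))) UNIV"
    by (intro has_sum_sum has_sum_cmult_right)
  then show ?thesis
    unfolding dual_moment_def G_def[symmetric] int
    by (simp add: infsumI sum_distrib_left[symmetric] del: of_real_power)
qed

section \<open>Averages over the annihilator of (p, q)\<close>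

text \<open>The annihilator of (p, q) is parametrised by theta = a - b and a residue j modulo p + q,
  where p a + q b = 2 pi j.\<close>

definition line_weight :: "nat \<Rightarrow> nat \<Rightarrow> nat \<Rightarrow> real \<Rightarrow> real" where
  "line_weight p q j \<theta> = tri_weight ((real q * \<theta> + 2 * pi * real j) / real (p + q))
     ((2 * pi * real j - real p * \<theta>) / real (p + q))"

lemma continuous_on_line_weight: "continuous_on A (line_weight p q j)"
  unfolding line_weight_def tri_weight_def divide_inverse by (intro continuous_intros)

lemma abs_line_weight_le: "\<bar>line_weight p q j \<theta>\<bar> \<le> 9"
proof -
  have "\<bar>tri_weight a b\<bar> \<le> 9" for a b
    unfolding tri_weight_def
    using abs_cos_le_one[of a] abs_cos_le_one[of b] abs_cos_le_one[of "a - b"] by linarith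
  then show ?thesis by (simp add: line_weight_def)
qed

text \<open>Two orthogonality relations act in turn: the sum over \<open>j\<close> selects the walks
  with \<open>m + l\<close> divisible by \<open>p + q\<close>, and the integral over
  \<open>\<theta>\<close> then removes every nonzero frequency. What survives is the same count as
  for the moments, scaled by the total length of the lines.\<close>

lemma sum_integral_line_weight_eq_count:
  assumes "p + q > 0" and "finite S"
    and S: "\<And>a b. of_real (tri_weight a b) ^ k = (\<Sum>g\<in>S. cis (of_int (m g) * a + of_int (l g) * b))"
  shows "of_real (\<Sum>j<p + q. integral {-pi..pi} (\<lambda>\<theta>. line_weight p q j \<theta> ^ k)) =
    of_real (2 * pi * real (p + q)) * (\<Sum>g\<in>S. if \<exists>s. m g = s * int p \<and> l g = s * int q then 1 else 0 :: complex)"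
proof -
  define n where "n = p + q"
  have n: "n > 0" "real p + real q = real n" "int p + int q = int n"
    using assms by (auto simp: n_def)
  have int: "((\<lambda>\<theta>. line_weight p q j \<theta> ^ k) has_integral
      integral {-pi..pi} (\<lambda>\<theta>. line_weight p q j \<theta> ^ k)) {-pi..pi}" for j
    by (intro integrable_integral integrable_continuous_interval continuous_on_power continuous_on_line_weight)
  have "of_real (\<Sum>j<n. integral {-pi..pi} (\<lambda>\<theta>. line_weight p q j \<theta> ^ k)) =
      integral {-pi..pi} (\<lambda>\<theta>. \<Sum>j<n. complex_of_real (line_weight p q j \<theta>) ^ k)"
    unfolding of_real_sum of_real_power[symmetric]
    by (intro integral_unique[symmetric] has_integral_sum has_integral_of_real int) simp
  also have "(\<lambda>\<theta>. \<Sum>j<n. complex_of_real (line_weight p q j \<theta>) ^ k) =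
      (\<lambda>\<theta>. \<Sum>g\<in>S. (if int n dvd m g + l g then of_nat n else 0) *
        cis (of_int (m g - (m g + l g) div int n * int p) * \<theta>))"
  proof
    fix \<theta>
    have "(\<Sum>j<n. cis (of_int (m g) * ((real q * \<theta> + 2 * pi * real j) / real n) +
              of_int (l g) * ((2 * pi * real j - real p * \<theta>) / real n))) =
          (if int n dvd m g + l g then of_nat n else 0) *
            cis (of_int (m g - (m g + l g) div int n * int p) * \<theta>)" for g
    proof -
      \<comment> \<open>The phase \<open>m a + l b\<close> splits into a part linear in
        \<open>j\<close> and a part linear in \<open>\<theta>\<close>.\<close>
      have "(\<Sum>j<n. cis (of_int (m g) * ((real q * \<theta> + 2 * pi * real j) / real n) +
              of_int (l g) * ((2 * pi * real j - real p * \<theta>) / real n))) =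
        (\<Sum>j<n. cis (2 * pi * real j * of_int (m g + l g) / real n) *
              cis ((of_int (m g) * real q - of_int (l g) * real p) * \<theta> / real n))"
        by (intro sum.cong refl) (simp add: cis_mult add_divide_distrib diff_divide_distrib algebra_simps)
      also have "\<dots> = (if int n dvd m g + l g then of_nat n else 0) *
              cis ((of_int (m g) * real q - of_int (l g) * real p) * \<theta> / real n)"
        using sum_cis_roots[OF n(1), of "m g + l g"] by (simp only: flip: sum_distrib_right)
      \<comment> \<open>If \<open>m + l = n s\<close>, then \<open>(m q - l p) / n\<close> is the
        integer \<open>m - s p\<close>, so orthogonality over a full period applies. Otherwise the
        coefficient is 0 and both sides vanish.\<close>
      also have "\<dots> = (if int n dvd m g + l g then of_nat n else 0) *
            cis (of_int (m g - (m g + l g) div int n * int p) * \<theta>)"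
      proof (cases "int n dvd m g + l g")
        case True
        then obtain s where s: "m g + l g = int n * s" ..
        then have l: "l g = int n * s - m g" by simp
        have "of_int (m g) * real q - of_int (l g) * real p = real n * of_int (m g - s * int p)"
          unfolding l using n(2)[symmetric] by (simp add: algebra_simps)
        then show ?thesis using s n by simp
      qed simp
      finally show ?thesis .
    qed
    then show "(\<Sum>j<n. complex_of_real (line_weight p q j \<theta>) ^ k) =
      (\<Sum>g\<in>S. (if int n dvd m g + l g then of_nat n else 0) *
        cis (of_int (m g - (m g + l g) div int n * int p) * \<theta>))"
      unfolding line_weight_def S n_def[symmetric] by (subst sum.swap) simp
  qed
  also have "integral {-pi..pi} \<dots> = (\<Sum>g\<in>S. (if int n dvd m g + l g then of_nat n else 0) *
     (if m g - (m g + l g) div int n * int p = 0 then of_real (2 * pi) else 0))"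
    by (rule integral_sum_cis[OF \<open>finite S\<close>])
  also have "\<dots> = of_real (2 * pi * real n) *
      (\<Sum>g\<in>S. if \<exists>s. m g = s * int p \<and> l g = s * int q then 1 else 0)"
    unfolding sum_distrib_left
  proof (intro sum.cong refl)
    fix g
    \<comment> \<open>From \<open>m + l = s (p + q)\<close> and \<open>m = s p\<close> it follows
      that \<open>l = s q\<close>.\<close>
    have "int n dvd m g + l g \<and> m g - (m g + l g) div int n * int p = 0 \<longleftrightarrow>
        (\<exists>s. m g = s * int p \<and> l g = s * int q)" (is "?L \<longleftrightarrow> ?R")
    proof
      assume ?L
      then obtain s where "m g + l g = int n * s" "m g = s * int p"
        using n(1) by auto
      then have "m g = s * int p" "l g = s * int q"
        using n(3)[symmetric] by (auto simp: algebra_simps)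
      then show ?R by blast
    next
      assume ?R
      then obtain s where s: "m g = s * int p" "l g = s * int q" by auto
      then have "m g + l g = int n * s"
        using n(3)[symmetric] by (auto simp: algebra_simps)
      then show ?L using s n(1) by simp
    qed
    then show "(if int n dvd m g + l g then of_nat n else 0) *
       (if m g - (m g + l g) div int n * int p = 0 then of_real (2 * pi) else 0) =
       complex_of_real (2 * pi * real n) * (if \<exists>s. m g = s * int p \<and> l g = s * int q then 1 else 0)"
      by auto
  qed
  finally show ?thesis by (simp only: n_def)
qed

text \<open>The Poisson summation step: the moment and the average were both computed as the same
  count of walks.\<close>

lemma dual_moment_eq_average:
  assumes "p + q > 0"
  shows "dual_moment p q k =
    of_real ((\<Sum>j<p + q. integral {-pi..pi} (\<lambda>\<theta>. line_weight p q j \<theta> ^ k)) / (2 * pi * real (p + q)))"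
proof -
  obtain S :: "(nat \<Rightarrow> (int \<times> int) \<times> (int \<times> int)) set" and m l
    where S: "finite S" "\<And>a b. of_real (tri_weight a b) ^ k = (\<Sum>g\<in>S. cis (of_int (m g) * a + of_int (l g) * b))"
    using tri_weight_power_eq_sum[of k] by blast
  have "complex_of_real (2 * pi * real (p + q)) \<noteq> 0"
    unfolding of_real_eq_0_iff using assms by (simp flip: of_nat_add)
  then show ?thesis
    unfolding dual_moment_eq_count[OF assms S] of_real_divide sum_integral_line_weight_eq_count[OF assms S]
    by (intro nonzero_mult_div_cancel_left[symmetric])
qed

section \<open>Trigonometric form and reflection symmetry of the exponent\<close>

text \<open>Sum-to-product turns \<open>cos a + cos b\<close> into
  \<open>2 cos ((a + b) / 2) cos (\<theta> / 2)\<close>. Here \<open>(a + b) / 2\<close> is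
  \<open>\<phi> - \<psi>\<close>, and the cosine of this difference separates the residue
  \<open>j\<close> from \<open>\<theta>\<close>.\<close>

lemma line_weight_eq_alpha_beta:
  assumes "p + q > 0"
  shows "line_weight p q j \<theta> = 3 + 2 * cos \<theta> +
    4 * (alpha p q \<theta> * cos (2 * pi * real j / real (p + q)) + beta p q \<theta> * sin (2 * pi * real j / real (p + q)))"
proof -
  define a b where "a = (real q * \<theta> + 2 * pi * real j) / real (p + q)"
    and "b = (2 * pi * real j - real p * \<theta>) / real (p + q)"
  have n: "real p + real q > 0" using assms by linarith
  have "a - b = (real p + real q) * \<theta> / (real p + real q)"
    unfolding a_def b_def diff_divide_distrib[symmetric] by (simp add: algebra_simps)
  then have "a - b = \<theta>" using n by simp
  define \<phi> \<psi> where "\<phi> = 2 * pi * real j / real (p + q)"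
    and "\<psi> = \<theta> * (real p - real q) / (2 * (real p + real q))"
  have "(a + b) / 2 = \<phi> - \<psi>"
    using n by (simp add: a_def b_def \<phi>_def \<psi>_def field_simps)
  with \<open>a - b = \<theta>\<close> have "cos a + cos b = 2 * (cos \<phi> * cos \<psi> + sin \<phi> * sin \<psi>) * cos (\<theta> / 2)"
    by (simp only: cos_plus_cos cos_diff)
  with \<open>a - b = \<theta>\<close> show ?thesis
    unfolding line_weight_def tri_weight_def a_def[symmetric] b_def[symmetric] alpha_def beta_def
      \<phi>_def[symmetric] \<psi>_def[symmetric]
    by (simp add: algebra_simps)
qed

text \<open>Under \<open>\<theta>\<close> to \<open>- \<theta>\<close> the function
  \<open>alpha\<close> is even and \<open>beta\<close> is odd. Negating \<open>j\<close> modulo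
  \<open>p + q\<close> flips the sine and undoes the change.\<close>

lemma sum_exp_line_weight_minus:
  assumes "p + q > 0"
  shows "(\<Sum>j<p + q. exp (t * line_weight p q j (- \<theta>))) = (\<Sum>j<p + q. exp (t * line_weight p q j \<theta>))"
proof -
  define n where "n = p + q"
  \<comment> \<open>The index 0 is fixed, since \<open>n - 0\<close> would leave the range; this
    makes \<open>r\<close> an involution of \<open>{..<n}\<close>.\<close>
  define r where "r j = (if j = 0 then 0 else n - j)" for j
  have "line_weight p q (r j) \<theta> = line_weight p q j (- \<theta>)" if "j < n" for j
  proof (cases "j = 0")
    case True
    then show ?thesis
      unfolding line_weight_eq_alpha_beta[OF assms] by (simp add: r_def alpha_def beta_def)
  next
    case False
    have "2 * pi * real (r j) / real n = 2 * pi - 2 * pi * real j / real n"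
      using that False by (simp add: r_def of_nat_diff field_simps)
    then show ?thesis
      unfolding line_weight_eq_alpha_beta[OF assms] n_def[symmetric]
      by (simp add: alpha_def beta_def cos_diff sin_diff)
  qed
  then show ?thesis
    unfolding n_def[symmetric]
    by (intro sum.reindex_bij_witness[of _ r r]) (auto simp: r_def)
qed

section \<open>From moments to the moment generating function\<close>

theorem theorem2:
  fixes p q :: nat and t :: real and M :: "'a measure" and X :: "'a \<Rightarrow> real"
  assumes "(p, q) \<in> nanotube_params"
    and "dual_random_eigenvalue p q M X"
  shows "mgf M X t =
    exp (3 * t) / pi *
    integral {0..pi} (\<lambda>\<theta>. exp (2 * t * cos \<theta>) *
      I0_hat (4 * t * alpha p q \<theta>) (4 * t * beta p q \<theta>) p q)"
proof -
  define n where "n = p + q"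
  have n: "n > 0" "p + q > 0" using assms(1) by (auto simp: nanotube_params_def n_def)
  define W where "W j \<theta> = line_weight p q j \<theta>" for j \<theta>
  define E where "E \<theta> = (\<Sum>j<n. exp (t * W j \<theta>))" for \<theta>
  obtain K where X: "prob_space M" "X \<in> borel_measurable M" "compact K" "AE \<omega> in M. X \<omega> \<in> K"
    and mom: "\<And>k. of_real (\<integral>\<omega>. X \<omega> ^ k \<partial>M) = dual_moment p q k"
    using assms(2) unfolding dual_random_eigenvalue_def by blast
  interpret prob_space M by fact
  have moment: "(\<integral>\<omega>. X \<omega> ^ k \<partial>M) = (\<Sum>j<n. integral {-pi..pi} (\<lambda>\<theta>. W j \<theta> ^ k)) / (2 * pi * real n)" for k
    using mom[of k] unfolding dual_moment_eq_average[OF n(2)] of_real_eq_iff W_def n_def .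
  obtain B where B: "\<And>x. x \<in> K \<Longrightarrow> \<bar>x\<bar> \<le> B"
    using compact_imp_bounded[OF X(3)] unfolding bounded_iff by auto
  have "AE \<omega> in M. \<bar>X \<omega>\<bar> \<le> B" using X(4) by eventually_elim (rule B)
  then have mgf: "(\<lambda>k. t ^ k / fact k * (\<integral>\<omega>. X \<omega> ^ k \<partial>M)) sums mgf M X t"
    unfolding mgf_def by (intro exp_moments_sums X finite_measure_axioms)
  have cont: "continuous_on A (W j)" for A j
    unfolding W_def by (rule continuous_on_line_weight)
  have lebesgue: "integral\<^sup>L (lebesgue_on {-pi..pi}) f = integral {-pi..pi} f"
    if "continuous_on {-pi..pi} f" for f :: "real \<Rightarrow> real"
    by (intro lebesgue_integral_eq_integral continuous_imp_integrable_real that) simp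
  \<comment> \<open>The exponential series is now summed for Lebesgue measure on a period, where
    each \<open>W j\<close> is bounded by 9.\<close>
  have "(\<lambda>k. t ^ k / fact k * integral {-pi..pi} (\<lambda>\<theta>. W j \<theta> ^ k)) sums
      integral {-pi..pi} (\<lambda>\<theta>. exp (t * W j \<theta>))" for j
  proof -
    have "(\<lambda>k. t ^ k / fact k * integral\<^sup>L (lebesgue_on {-pi..pi}) (\<lambda>\<theta>. W j \<theta> ^ k)) sums
        integral\<^sup>L (lebesgue_on {-pi..pi}) (\<lambda>\<theta>. exp (t * W j \<theta>))"
    proof (rule exp_moments_sums)
      show "finite_measure (lebesgue_on {-pi..pi})"
        by (intro finite_measure_lebesgue_on) simp
      show "W j \<in> borel_measurable (lebesgue_on {-pi..pi})"
        by (intro continuous_imp_measurable_on_sets_lebesgue cont) simp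
      show "AE \<theta> in lebesgue_on {-pi..pi}. \<bar>W j \<theta>\<bar> \<le> 9"
        by (simp add: W_def abs_line_weight_le)
    qed
    then show ?thesis
      by (simp add: lebesgue continuous_intros cont)
  qed
  then have "(\<lambda>k. (\<Sum>j<n. t ^ k / fact k * integral {-pi..pi} (\<lambda>\<theta>. W j \<theta> ^ k)) / (2 * pi * real n)) sums
      ((\<Sum>j<n. integral {-pi..pi} (\<lambda>\<theta>. exp (t * W j \<theta>))) / (2 * pi * real n))"
    by (intro sums_divide sums_sum)
  \<comment> \<open>Both series have the same terms by \<open>moment\<close>, so their limits
    agree.\<close>
  then have "mgf M X t = (\<Sum>j<n. integral {-pi..pi} (\<lambda>\<theta>. exp (t * W j \<theta>))) / (2 * pi * real n)"
    using mgf by (simp add: moment sum_distrib_left sums_unique2)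
  also have "(\<Sum>j<n. integral {-pi..pi} (\<lambda>\<theta>. exp (t * W j \<theta>))) = integral {-pi..pi} E"
    unfolding E_def
    by (intro integral_sum[symmetric] integrable_continuous_interval continuous_intros cont) simp
  \<comment> \<open>\<open>E\<close> is even, although its individual summands need not be.\<close>
  also have "\<dots> = 2 * integral {0..pi} E"
  proof -
    have "continuous_on A E" for A
      unfolding E_def by (intro continuous_intros cont)
    then have "E integrable_on {-pi..pi}"
      by (intro integrable_continuous_interval)
    then have "integral {-pi..pi} E = integral {-pi..0} E + integral {0..pi} E"
      by (simp add: Henstock_Kurzweil_Integration.integral_combine)
    also have "integral {-pi..0} E = integral {-pi..0} (\<lambda>\<theta>. E (- \<theta>))"
      unfolding E_def W_def n_def sum_exp_line_weight_minus[OF n(2)] ..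
    also have "\<dots> = integral {0..pi} E"
      using Henstock_Kurzweil_Integration.integral_reflect_real[of pi 0 E] by simp
    finally show ?thesis by simp
  qed
  also have "2 * integral {0..pi} E / (2 * pi * real n) = 1 / pi * integral {0..pi} (\<lambda>\<theta>. E \<theta> / real n)"
    by simp
  also have "(\<lambda>\<theta>. E \<theta> / real n) = (\<lambda>\<theta>. exp (3 * t) * (exp (2 * t * cos \<theta>) *
      I0_hat (4 * t * alpha p q \<theta>) (4 * t * beta p q \<theta>) p q))"
  proof
    fix \<theta>
    \<comment> \<open>The truncated subtraction is harmless because \<open>n\<close> is
      positive.\<close>
    have "{0..p + q - 1} = {..<n}" using n by (auto simp: n_def)
    moreover have "exp (t * W j \<theta>) = exp (3 * t) * exp (2 * t * cos \<theta>) *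
        exp (4 * t * alpha p q \<theta> * cos (2 * pi * real j / real (p + q)) +
          4 * t * beta p q \<theta> * sin (2 * pi * real j / real (p + q)))" for j
      unfolding W_def line_weight_eq_alpha_beta[OF n(2)] exp_add[symmetric]
      by (simp add: algebra_simps)
    ultimately show "E \<theta> / real n = exp (3 * t) * (exp (2 * t * cos \<theta>) *
      I0_hat (4 * t * alpha p q \<theta>) (4 * t * beta p q \<theta>) p q)"
      unfolding E_def I0_hat_def by (simp add: sum_distrib_left[symmetric] n_def)
  qed
  finally show ?thesis by simp
qed

end
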